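(* Let $\mathcal{T}\subset\mathbb{R}^d$ be a Borel set, $t_0\in\mathbb{R}^d\setminus\mathcal{T}$, and let $y(t)=\theta^\top f(t)+\epsilon(t)$, $t\in\mathcal{T}\cup\{t_0\}$, where $f$ is a known $\mathbb{R}^m$-valued function, $\theta\in\mathbb{R}^m$ is unknown, and $\epsilon$ is a zero-mean random field with covariance kernel $K(t,s)=\mathbb{E}[\epsilon(t)\epsilon(s)]$, subject to the standing assumptions in the context. Assume that (1) the best linear unbiased estimator (BLUE) $\hat\theta_{\mathrm{BLUE}}=\int_{\mathcal{T}}y(t)\,G(dt)$ of $\theta$ exists, where $G$ is some signed $\mathbb{R}^m$-valued vector measure on $\mathcal{T}$; and (2) there exists a signed measure $\zeta_{t_0}$ on $\mathcal{T}$ such that $$\int_{\mathcal{T}}K(t,s)\,\zeta_{t_0}(dt)=K(t_0,s)\qquad\text{for all } s\in\mathcal{T}.$$ Then the BLUP measure $Q_*$ for predicting $y(t_0)$ exists and is given by $$Q_*(dt)=\zeta_{t_0}(dt)+c^\top G(dt),\qquad c=f(t_0)-\int_{\mathcal{T}}f(t)\,\zeta_{t_0}(dt).$$ The mean squared error of the corresponding BLUP $\hat y_{Q_*}(t_0)=\int_{\mathcal{T}}y(t)\,Q_*(dt)$ is $$\mathrm{MSE}(\hat y_{Q_*}(t_0))=K(t_0,t_0)+c^\top D f(t_0)-\int_{\mathcal{T}}K(t,t_0)\,Q_*(dt),$$ where $D=\int_{\mathcal{T}}\int_{\mathcal{T}}K(t,s)\,G(dt)\,G^\top(ds)$ is the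 covariance matrix of $\hat\theta_{\mathrm{BLUE}}$.
   Context: Standing assumptions: the components of $f$ are bounded, integrable and linearly independent as functions on $\mathcal{T}$; the kernel $K$ is strictly positive definite. The field $y$ is observed at all $t\in\mathcal{T}$. Convention on integrals: signed measures are finite signed Borel measures for which the integrals of $f$ and the double integrals of $K$ that occur converge absolutely; the stochastic integral $\int y\,dQ$ is a random variable with mean $\theta^\top\int f\,dQ$, and the covariance of $\int\epsilon\,dQ_1$ and $\int\epsilon\,dQ_2$ is $\iint K(t,s)\,Q_1(dt)\,Q_2(ds)$. Finite combinations of point masses are admissible. Linear predictors: for a signed measure $Q$ on $\mathcal{T}$, $\hat y_Q(t_0)=\int_{\mathcal{T}}y(t)\,Q(dt)$. It is unbiased if $\mathbb{E}[\hat y_Q(t_0)]=\mathbb{E}[y(t_0)]$ for all $\theta$, i.e. $\int_{\mathcal{T}}f(t)\,Q(dt)=f(t_0)$. Its mean squared error is $\mathrm{MSE}(\hat y_Q(t_0))=\mathbb{E}(y(t_0)-\hat y_Q(t_0))^2$. A BLUP measure is a signed measure $Q_*$ such that $\hat y_{Q_*}(t_0)$ (the best linear unbiased predictor, BLUP) is unbiased and minimizes $\mathrm{MSE}$ among all linear unbiased predictors $\hat y_Q(t_0)$. BLUE: a linear estimator $\int_{\mathcal{T}}y(t)\,G(dt)$, with $G$ a signed $\mathbb{R}^m$-valued measure on $\mathcal{T}$, is unbiased for $\theta$ if $\int_{\mathcal{T}}f(t)\,G^\top(dt)=I_m$; it is the BLUE if it is unbiased and its covariance matrix is minimal in the Loewner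 order among all linear unbiased estimators. It is known that this holds if and only if $\int_{\mathcal{T}}f(t)\,G^\top(dt)=I_m$ and $\int_{\mathcal{T}}K(t,s)\,G(dt)=Df(s)$ for all $s\in\mathcal{T}$ and some $m\times m$ matrix $D$; then $D$ is the covariance matrix of the BLUE (possibly degenerate). *)

theory Defs
  imports "HOL-Probability.Probability"
begin

text \<open>
  A (real- or vector-valued) finite signed Borel measure on a Borel set \<open>T\<close> is a
  countably additive function on the Borel sets of the ambient space that is concentrated on
  \<open>T\<close>. The values on non-Borel sets are irrelevant. Countable additivity for the
  constant sequence of empty sets forces the value \<open>0\<close> on the empty set.
\<close>

definition signed_measure_on ::
    "'a::topological_space set \<Rightarrow> ('a set \<Rightarrow> 'b::real_normed_vector) \<Rightarrow> bool" where
  "signed_measure_on T Q \<longleftrightarrow>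
     (\<forall>A::nat \<Rightarrow> 'a set. range A \<subseteq> sets borel \<longrightarrow> disjoint_family A \<longrightarrow>
        (\<lambda>n. Q (A n)) sums Q (\<Union>n. A n)) \<and>
     (\<forall>A\<in>sets borel. Q A = Q (A \<inter> T))"

definition point_mass :: "'a \<Rightarrow> 'a set \<Rightarrow> real" where
  "point_mass t = (\<lambda>A. indicator A t)"

text \<open>
  Upper, lower and total variation of a signed measure. Negative values \<open>Q B\<close> are
  truncated to \<open>0\<close> by \<^const>\<open>ennreal\<close>, which is harmless since the
  empty set contributes \<open>0\<close> to the supremum.
\<close>

definition pos_var :: "('a::topological_space set \<Rightarrow> real) \<Rightarrow> 'a measure" where
  "pos_var Q = measure_of UNIV (sets borel) (\<lambda>A. \<Squnion>B\<in>{B\<in>sets borel. B \<subseteq> A}. ennreal (Q B))"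

definition neg_var :: "('a::topological_space set \<Rightarrow> real) \<Rightarrow> 'a measure" where
  "neg_var Q = pos_var (\<lambda>A. - Q A)"

definition tot_var :: "('a::topological_space set \<Rightarrow> real) \<Rightarrow> 'a measure" where
  "tot_var Q = measure_of UNIV (sets borel) (\<lambda>A. emeasure (pos_var Q) A + emeasure (neg_var Q) A)"

definition sm_integral :: "'a::topological_space set \<Rightarrow> ('a set \<Rightarrow> real) \<Rightarrow>
    ('a \<Rightarrow> 'b::{banach, second_countable_topology}) \<Rightarrow> 'b" where
  "sm_integral T Q g = (LINT t:T|pos_var Q. g t) - (LINT t:T|neg_var Q. g t)"

definition sm_double_integral :: "'a::topological_space set \<Rightarrow>
    ('a set \<Rightarrow> real) \<Rightarrow> ('a set \<Rightarrow> real) \<Rightarrow> ('a \<Rightarrow> 'a \<Rightarrow> real) \<Rightarrow> real" where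
  "sm_double_integral T P Q K = sm_integral T Q (\<lambda>s. sm_integral T P (\<lambda>t. K t s))"

definition sm_component :: "('a set \<Rightarrow> real ^ 'm) \<Rightarrow> 'm \<Rightarrow> 'a set \<Rightarrow> real" where
  "sm_component G i = (\<lambda>A. G A $ i)"

definition covariance :: "'w measure \<Rightarrow> ('w \<Rightarrow> real) \<Rightarrow> ('w \<Rightarrow> real) \<Rightarrow> real" where
  "covariance M X Y = (LINT w|M. (X w - (LINT v|M. X v)) * (Y w - (LINT v|M. Y v)))"

definition centred_field :: "'w measure \<Rightarrow> 't set \<Rightarrow> ('t \<Rightarrow> 't \<Rightarrow> real) \<Rightarrow>
    ('t \<Rightarrow> 'w \<Rightarrow> real) \<Rightarrow> bool" where
  "centred_field M U K \<epsilon> \<longleftrightarrow>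
     (\<forall>t\<in>U. \<epsilon> t \<in> borel_measurable M \<and> integrable M (\<lambda>w. (\<epsilon> t w)\<^sup>2) \<and> (LINT w|M. \<epsilon> t w) = 0) \<and>
     (\<forall>t\<in>U. \<forall>s\<in>U. K t s = (LINT w|M. \<epsilon> t w * \<epsilon> s w))"

definition strictly_pos_def :: "'t set \<Rightarrow> ('t \<Rightarrow> 't \<Rightarrow> real) \<Rightarrow> bool" where
  "strictly_pos_def U K \<longleftrightarrow>
     (\<forall>S a. finite S \<longrightarrow> S \<subseteq> U \<longrightarrow> (\<exists>s\<in>S. a s \<noteq> 0) \<longrightarrow> (\<Sum>t\<in>S. \<Sum>s\<in>S. a t * a s * K t s) > 0)"

definition lin_indep_on :: "'t set \<Rightarrow> ('t \<Rightarrow> real ^ 'm) \<Rightarrow> bool" where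
  "lin_indep_on T f \<longleftrightarrow> (\<forall>c. (\<forall>t\<in>T. c \<bullet> f t = 0) \<longrightarrow> c = 0)"

text \<open>
  A linear class \<open>\<Q>\<close> of signed measures on \<open>T\<close> containing the point masses, such that
  every integral of \<open>f\<close> and every double integral of \<open>K\<close> formed from its members (and
  from the point mass at \<open>t\<^sub>0\<close>) converges absolutely. If \<open>f\<close> and \<open>K\<close> are bounded
  and Borel measurable, all finite signed measures on \<open>T\<close> form such a class. For unbounded \<open>K\<close> the condition has to be
  imposed on pairs, since absolute convergence for \<open>(P, P)\<close> and \<open>(Q, Q)\<close> is not known to
  give it for \<open>(P, Q)\<close>.
\<close>

definition admissible_class :: "(real ^ 'd) set \<Rightarrow> real ^ 'd \<Rightarrow> (real ^ 'd \<Rightarrow> real ^ 'm) \<Rightarrow>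
    (real ^ 'd \<Rightarrow> real ^ 'd \<Rightarrow> real) \<Rightarrow> ((real ^ 'd) set \<Rightarrow> real) set \<Rightarrow> bool" where
  "admissible_class T t\<^sub>0 f K \<Q> \<longleftrightarrow>
     (\<forall>Q\<in>\<Q>. signed_measure_on T Q) \<and>
     (\<forall>t\<in>T. point_mass t \<in> \<Q>) \<and>
     (\<forall>P\<in>\<Q>. \<forall>Q\<in>\<Q>. \<forall>a b. (\<lambda>A. a * P A + b * Q A) \<in> \<Q>) \<and>
     (\<forall>Q\<in>\<Q>. set_integrable (tot_var Q) T f) \<and>
     (\<forall>P\<in>\<Q>. \<forall>Q\<in>\<Q>. set_integrable (tot_var P \<Otimes>\<^sub>M tot_var Q) (T \<times> T) (\<lambda>(t, s). K t s)) \<and>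
     (\<forall>Q\<in>\<Q>. set_integrable (tot_var Q) T (\<lambda>t. K t t\<^sub>0))"

text \<open>
  \<open>J Q\<close> is the stochastic integral of \<open>\<epsilon>\<close> with respect to \<open>Q\<close>: a square integrable centred
  random variable with the prescribed covariances. The last clause is the covariance formula
  for \<open>Q\<close> and the point mass at \<open>s\<close>, whose stochastic integral is \<open>\<epsilon> s\<close>. These conditions
  determine \<open>J Q\<close> almost surely to be linear in \<open>Q\<close>, with \<open>J (point_mass s) = \<epsilon> s\<close> almost
  surely for \<open>s \<in> T\<close>. No pathwise integrability of \<open>\<epsilon>\<close> is required.
\<close>

definition stochastic_integral :: "'w measure \<Rightarrow> 'a::topological_space set \<Rightarrow> 'a \<Rightarrow>
    ('a \<Rightarrow> 'a \<Rightarrow> real) \<Rightarrow> ('a \<Rightarrow> 'w \<Rightarrow> real) \<Rightarrow> ('a set \<Rightarrow> real) set \<Rightarrow>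
    (('a set \<Rightarrow> real) \<Rightarrow> 'w \<Rightarrow> real) \<Rightarrow> bool" where
  "stochastic_integral M T t\<^sub>0 K \<epsilon> \<Q> J \<longleftrightarrow>
     (\<forall>Q\<in>\<Q>. J Q \<in> borel_measurable M \<and> integrable M (\<lambda>w. (J Q w)\<^sup>2) \<and> (LINT w|M. J Q w) = 0) \<and>
     (\<forall>P\<in>\<Q>. \<forall>Q\<in>\<Q>. covariance M (J P) (J Q) = sm_double_integral T P Q K) \<and>
     (\<forall>Q\<in>\<Q>. \<forall>s\<in>T \<union> {t\<^sub>0}. covariance M (J Q) (\<epsilon> s) = sm_integral T Q (\<lambda>t. K t s))"

definition obs :: "('a \<Rightarrow> real ^ 'm) \<Rightarrow> ('a \<Rightarrow> 'w \<Rightarrow> real) \<Rightarrow> real ^ 'm \<Rightarrow> 'a \<Rightarrow> 'w \<Rightarrow> real" where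
  "obs f \<epsilon> \<theta> t w = \<theta> \<bullet> f t + \<epsilon> t w"

text \<open>
  The integral of \<^const>\<open>obs\<close> against \<open>Q\<close>: an ordinary integral of the trend plus the stochastic
  integral \<open>J Q\<close> of the noise.
\<close>

definition obs_integral :: "'a::topological_space set \<Rightarrow> ('a \<Rightarrow> real ^ 'm) \<Rightarrow>
    (('a set \<Rightarrow> real) \<Rightarrow> 'w \<Rightarrow> real) \<Rightarrow> real ^ 'm \<Rightarrow> ('a set \<Rightarrow> real) \<Rightarrow> 'w \<Rightarrow> real" where
  "obs_integral T f J \<theta> Q w = \<theta> \<bullet> sm_integral T Q f + J Q w"

definition unbiased_predictor :: "'w measure \<Rightarrow> 'a::topological_space set \<Rightarrow> 'a \<Rightarrow>
    ('a \<Rightarrow> real ^ 'm) \<Rightarrow> ('a \<Rightarrow> 'w \<Rightarrow> real) \<Rightarrow> (('a set \<Rightarrow> real) \<Rightarrow> 'w \<Rightarrow> real) \<Rightarrow>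
    ('a set \<Rightarrow> real) \<Rightarrow> bool" where
  "unbiased_predictor M T t\<^sub>0 f \<epsilon> J Q \<longleftrightarrow>
     (\<forall>\<theta>. (LINT w|M. obs_integral T f J \<theta> Q w) = (LINT w|M. obs f \<epsilon> \<theta> t\<^sub>0 w))"

definition MSE :: "'w measure \<Rightarrow> 'a::topological_space set \<Rightarrow> 'a \<Rightarrow>
    ('a \<Rightarrow> real ^ 'm) \<Rightarrow> ('a \<Rightarrow> 'w \<Rightarrow> real) \<Rightarrow> (('a set \<Rightarrow> real) \<Rightarrow> 'w \<Rightarrow> real) \<Rightarrow>
    real ^ 'm \<Rightarrow> ('a set \<Rightarrow> real) \<Rightarrow> real" where
  "MSE M T t\<^sub>0 f \<epsilon> J \<theta> Q = (LINT w|M. (obs f \<epsilon> \<theta> t\<^sub>0 w - obs_integral T f J \<theta> Q w)\<^sup>2)"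

definition BLUP_measure :: "'w measure \<Rightarrow> 'a::topological_space set \<Rightarrow> 'a \<Rightarrow>
    ('a \<Rightarrow> real ^ 'm) \<Rightarrow> ('a \<Rightarrow> 'w \<Rightarrow> real) \<Rightarrow> ('a set \<Rightarrow> real) set \<Rightarrow>
    (('a set \<Rightarrow> real) \<Rightarrow> 'w \<Rightarrow> real) \<Rightarrow> ('a set \<Rightarrow> real) \<Rightarrow> bool" where
  "BLUP_measure M T t\<^sub>0 f \<epsilon> \<Q> J Q \<longleftrightarrow>
     Q \<in> \<Q> \<and> unbiased_predictor M T t\<^sub>0 f \<epsilon> J Q \<and>
     (\<forall>Q'\<in>\<Q>. unbiased_predictor M T t\<^sub>0 f \<epsilon> J Q' \<longrightarrow>
        (\<forall>\<theta>. MSE M T t\<^sub>0 f \<epsilon> J \<theta> Q \<le> MSE M T t\<^sub>0 f \<epsilon> J \<theta> Q'))"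

definition linear_estimator :: "'a::topological_space set \<Rightarrow> ('a \<Rightarrow> real ^ 'm) \<Rightarrow>
    (('a set \<Rightarrow> real) \<Rightarrow> 'w \<Rightarrow> real) \<Rightarrow> real ^ 'm \<Rightarrow> ('a set \<Rightarrow> real ^ 'm) \<Rightarrow> 'w \<Rightarrow> real ^ 'm" where
  "linear_estimator T f J \<theta> G w = (\<chi> i. obs_integral T f J \<theta> (sm_component G i) w)"

definition unbiased_estimator :: "'a::topological_space set \<Rightarrow> ('a \<Rightarrow> real ^ 'm) \<Rightarrow>
    ('a set \<Rightarrow> real ^ 'm) \<Rightarrow> bool" where
  "unbiased_estimator T f G \<longleftrightarrow>
     (\<chi> i j. sm_integral T (sm_component G j) (\<lambda>t. f t $ i)) = (mat 1 :: real ^ 'm ^ 'm)"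

definition cov_matrix :: "'w measure \<Rightarrow> ('w \<Rightarrow> real ^ 'm) \<Rightarrow> real ^ 'm ^ 'm" where
  "cov_matrix M X = (\<chi> i j. covariance M (\<lambda>w. X w $ i) (\<lambda>w. X w $ j))"

text \<open>Loewner order; it is only applied to covariance matrices, which are symmetric.\<close>

definition loewner_le :: "real ^ 'm ^ 'm \<Rightarrow> real ^ 'm ^ 'm \<Rightarrow> bool" where
  "loewner_le A B \<longleftrightarrow> (\<forall>v. v \<bullet> (A *v v) \<le> v \<bullet> (B *v v))"

definition vector_measures :: "'a::topological_space set \<Rightarrow> ('a set \<Rightarrow> real) set \<Rightarrow>
    ('a set \<Rightarrow> real ^ 'm) set" where
  "vector_measures T \<Q> = {G. signed_measure_on T G \<and> (\<forall>i. sm_component G i \<in> \<Q>)}"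

definition BLUE_measure :: "'w measure \<Rightarrow> 'a::topological_space set \<Rightarrow> ('a \<Rightarrow> real ^ 'm) \<Rightarrow>
    ('a set \<Rightarrow> real) set \<Rightarrow> (('a set \<Rightarrow> real) \<Rightarrow> 'w \<Rightarrow> real) \<Rightarrow> ('a set \<Rightarrow> real ^ 'm) \<Rightarrow> bool" where
  "BLUE_measure M T f \<Q> J G \<longleftrightarrow>
     G \<in> vector_measures T \<Q> \<and> unbiased_estimator T f G \<and>
     (\<forall>H\<in>vector_measures T \<Q>. unbiased_estimator T f H \<longrightarrow>
        (\<forall>\<theta>. loewner_le (cov_matrix M (linear_estimator T f J \<theta> G))
                        (cov_matrix M (linear_estimator T f J \<theta> H))))"

end

theory Submission
  imports Defs
begin

text \<open>
  The covariances of stochastic integrals make the double integral of \<open>K\<close> a positive semidefinite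
  symmetric bilinear form \<open>b\<close> on the admissible measures. Varying the BLUE inside the
  unbiased estimators shows \<open>b (G\<^sub>i, R) = 0\<close> for every \<open>R\<close> with \<open>\<integral>f dR = 0\<close>; since moreover
  \<open>b (\<zeta>, R) = \<integral>K(t, t\<^sub>0) R(dt)\<close>, the prediction error of \<open>Q\<^sub>*\<close> is uncorrelated with \<open>\<integral>\<epsilon> dR\<close>,
  which is optimality. Applying the orthogonality to \<open>R = Q\<^sub>* - f(t\<^sub>0)\<^sup>T G\<close> yields the mean
  squared error. The one analytic ingredient is that integrals depend linearly on
  the signed measure, which rests on the Jordan decomposition.
\<close>

subsection \<open>Jordan decomposition\<close>

context
  fixes T :: "'a::topological_space set" and Q :: "'a set \<Rightarrow> 'b::real_normed_vector"
  assumes Q: "signed_measure_on T Q"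
begin

lemma signed_measure_on_sums:
  assumes "range A \<subseteq> sets borel" "disjoint_family A"
  shows "(\<lambda>n. Q (A n)) sums Q (\<Union>n. A n)"
  using Q assms unfolding signed_measure_on_def by blast

lemma signed_measure_on_empty: "Q {} = 0"
proof -
  have "(\<lambda>n::nat. Q {}) sums Q (\<Union>n::nat. {})"
    by (rule signed_measure_on_sums) (auto simp: disjoint_family_on_def)
  then have "(\<lambda>n::nat. Q {}) \<longlonglongrightarrow> 0"
    using summable_LIMSEQ_zero sums_summable by blast
  then show ?thesis
    by (simp add: LIMSEQ_const_iff)
qed

lemma signed_measure_on_Un:
  assumes "A \<in> sets borel" "B \<in> sets borel" "A \<inter> B = {}"
  shows "Q (A \<union> B) = Q A + Q B"
proof -
  have "(\<lambda>n. Q (binaryset A B n)) sums Q (\<Union>n. binaryset A B n)"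
    using assms by (intro signed_measure_on_sums)
      (auto simp: range_binaryset_eq disjoint_family_on_def binaryset_def)
  moreover have "(\<lambda>n. Q (binaryset A B n)) sums (Q A + Q B)"
    by (rule binaryset_sums) (rule signed_measure_on_empty)
  ultimately show ?thesis
    using sums_unique2 by (metis UN_binaryset_eq)
qed

lemma signed_measure_on_Diff:
  assumes "A \<in> sets borel" "B \<in> sets borel" "B \<subseteq> A"
  shows "Q (A - B) = Q A - Q B"
  using signed_measure_on_Un[of B "A - B"] assms by (auto simp: Un_absorb1)

end

lemma signed_measure_on_uminus:
  "signed_measure_on T Q \<Longrightarrow> signed_measure_on T (\<lambda>A. - Q A)"
  unfolding signed_measure_on_def by (auto intro!: sums_minus)

text \<open>Truncation at \<open>0\<close> is subadditive. Strict inequality occurs when summands of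
  both signs cancel, as the values of a signed measure may.\<close>

lemma ennreal_sum_le: "ennreal (\<Sum>i\<in>I. r i) \<le> (\<Sum>i\<in>I. ennreal (r i))"
proof (induction I rule: infinite_finite_induct)
  case (insert i I)
  have "ennreal (r i + (\<Sum>i\<in>I. r i)) \<le> ennreal (r i) + ennreal (\<Sum>i\<in>I. r i)"
    by (cases "r i \<ge> 0"; cases "(\<Sum>i\<in>I. r i) \<ge> 0")
      (auto simp flip: ennreal_plus simp: ennreal_neg intro!: ennreal_leI)
  also have "\<dots> \<le> ennreal (r i) + (\<Sum>i\<in>I. ennreal (r i))"
    using insert by (intro add_left_mono)
  finally show ?case
    using insert by simp
qed auto

section \<open>The variations of a signed measure as finite measures\<close>

lemma sets_pos_var [simp, measurable_cong]: "sets (pos_var Q) = sets borel"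
  using sets.sets_measure_of_eq[of borel] by (simp add: pos_var_def)

lemma space_pos_var [simp]: "space (pos_var Q) = UNIV"
  using sets_eq_imp_space_eq[OF sets_pos_var] by simp

lemma sets_neg_var [simp, measurable_cong]: "sets (neg_var Q) = sets borel"
  by (simp add: neg_var_def)

lemma sets_tot_var [simp, measurable_cong]: "sets (tot_var Q) = sets borel"
  using sets.sets_measure_of_eq[of borel] by (simp add: tot_var_def)

lemma space_tot_var [simp]: "space (tot_var Q) = UNIV"
  using sets_eq_imp_space_eq[OF sets_tot_var] by simp

lemma emeasure_tot_var:
  "emeasure (tot_var Q) A = emeasure (pos_var Q) A + emeasure (neg_var Q) A"
proof (cases "A \<in> sets borel")
  case True
  have "emeasure (tot_var Q) A = (\<lambda>A. emeasure (pos_var Q) A + emeasure (neg_var Q) A) A"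
    unfolding tot_var_def
  proof (rule emeasure_measure_of_sigma)
    show "sigma_algebra UNIV (sets borel)"
      using sets.sigma_algebra_axioms[of borel] by simp
    show "countably_additive (sets borel) (\<lambda>A. emeasure (pos_var Q) A + emeasure (neg_var Q) A)"
      by (auto simp: countably_additive_def suminf_emeasure suminf_add[OF summableI summableI, symmetric])
  qed (use True in \<open>auto simp: positive_def\<close>)
  then show ?thesis by simp
qed (simp add: emeasure_notin_sets)

text \<open>\<open>measure_of\<close> returns the given set function only if it is countably
  additive, so this has to be proved for the supremum. One inequality glues subsets of disjoint sets
  together; the other cuts a subset of the union along the pieces \<open>A i\<close>.\<close>

lemma emeasure_pos_var:
  assumes Q: "signed_measure_on T Q" and "A \<in> sets borel"
  shows "emeasure (pos_var Q) A = (\<Squnion>B\<in>{B\<in>sets borel. B \<subseteq> A}. ennreal (Q B))"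
proof -
  define p where "p A = (\<Squnion>B\<in>{B\<in>sets borel. B \<subseteq> A}. ennreal (Q B))" for A
  have le_p: "ennreal (Q B) \<le> p A" if "B \<in> sets borel" "B \<subseteq> A" for A B
    unfolding p_def using that by (intro SUP_upper) auto
  have p_mono: "p A \<le> p B" if "A \<subseteq> B" for A B
    unfolding p_def using that by (intro SUP_subset_mono) auto
  have super: "p A + p B \<le> p (A \<union> B)" if "A \<inter> B = {}" for A B
  proof -
    have "ennreal (Q A') + ennreal (Q B') \<le> p (A \<union> B)"
      if *: "A' \<in> sets borel" "A' \<subseteq> A" "B' \<in> sets borel" "B' \<subseteq> B" for A' B'
    proof (cases "Q A' \<ge> 0 \<and> Q B' \<ge> 0")
      case True
      then have "ennreal (Q A') + ennreal (Q B') = ennreal (Q (A' \<union> B'))"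
        using * \<open>A \<inter> B = {}\<close> by (subst signed_measure_on_Un[OF Q]) auto
      also have "\<dots> \<le> p (A \<union> B)"
        using * by (intro le_p) auto
      finally show ?thesis .
    next
      \<comment> \<open>A negative value is truncated to \<open>0\<close>, and monotonicity bounds
        the summand that remains.\<close>
      case False
      then show ?thesis
        using le_p[OF *(1) le_supI1[OF *(2)]] le_p[OF *(3) le_supI2[OF *(4)]]
        by (auto simp: ennreal_neg)
    qed
    note le = this
    \<comment> \<open>A constant can be pulled into a supremum in \<open>ennreal\<close> only if the
      index set is nonempty.\<close>
    have ne: "{B\<in>sets borel. B \<subseteq> C} \<noteq> {}" for C :: "'a set"
      by blast
    have "ennreal (Q A') + p B \<le> p (A \<union> B)" if "A' \<in> sets borel" "A' \<subseteq> A" for A'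
      unfolding p_def[of B] ennreal_SUP_add_right[OF ne] using that le by (intro SUP_least) auto
    then show ?thesis
      unfolding p_def[of A] ennreal_SUP_add_left[OF ne, symmetric] by (intro SUP_least) auto
  qed
  have p_empty: "p {} = 0"
    unfolding p_def by (simp add: signed_measure_on_empty[OF Q] cong: conj_cong)
  have "emeasure (pos_var Q) A = p A"
    unfolding pos_var_def p_def[symmetric]
  proof (rule emeasure_measure_of_sigma)
    show "sigma_algebra UNIV (sets borel)"
      using sets.sigma_algebra_axioms[of borel] by simp
    show "positive (sets borel) p"
      using p_empty by (simp add: positive_def)
    show "countably_additive (sets borel) p"
    proof (rule countably_additiveI, rule antisym)
      fix A :: "nat \<Rightarrow> 'a set"
      assume A: "range A \<subseteq> sets borel" "disjoint_family A"
      have "sum (\<lambda>i. p (A i)) {..<n} \<le> p (\<Union>i<n. A i)" for n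
      proof (induction n)
        case (Suc n)
        have "(\<Union>i<n. A i) \<inter> A n = {}"
          using A(2) unfolding disjoint_family_on_def by (blast dest: less_imp_neq)
        then have "p (\<Union>i<n. A i) + p (A n) \<le> p (\<Union>i<Suc n. A i)"
          using super[of "\<Union>i<n. A i" "A n"] by (simp add: lessThan_Suc Un_commute)
        with add_right_mono[OF Suc, of "p (A n)"] show ?case
          unfolding sum.lessThan_Suc by (rule order_trans)
      qed (simp add: p_empty)
      from order_trans[OF this p_mono]
      have "sum (\<lambda>i. p (A i)) {..<n} \<le> p (\<Union>i. A i)" for n
        by blast
      then show "(\<Sum>i. p (A i)) \<le> p (\<Union>i. A i)"
        by (rule suminf_le_const[OF summableI])
      show "p (\<Union>i. A i) \<le> (\<Sum>i. p (A i))"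
        unfolding p_def[of "\<Union>i. A i"]
      proof (rule SUP_least)
        fix B assume B: "B \<in> {B \<in> sets borel. B \<subseteq> (\<Union>i. A i)}"
        then have "(\<lambda>i. Q (B \<inter> A i)) sums Q (\<Union>i. B \<inter> A i)"
          using A by (intro signed_measure_on_sums[OF Q]) (auto simp: disjoint_family_on_def)
        moreover have "(\<Union>i. B \<inter> A i) = B"
          using B by auto
        \<comment> \<open>Truncation is continuous, so the truncated partial sums tend to the
          truncation of \<open>Q B\<close>; subadditivity of truncation bounds each of them.\<close>
        ultimately have "(\<lambda>n. ennreal (\<Sum>i<n. Q (B \<inter> A i))) \<longlonglongrightarrow> ennreal (Q B)"
          by (auto simp: sums_def intro: tendsto_ennrealI)
        moreover have "ennreal (\<Sum>i<n. Q (B \<inter> A i)) \<le> (\<Sum>i. p (A i))" for n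
        proof -
          have "ennreal (\<Sum>i<n. Q (B \<inter> A i)) \<le> (\<Sum>i<n. p (A i))"
            using A B by (intro order_trans[OF ennreal_sum_le] sum_mono le_p) auto
          also have "\<dots> \<le> (\<Sum>i. p (A i))"
            by (intro sum_le_suminf) auto
          finally show ?thesis .
        qed
        ultimately show "ennreal (Q B) \<le> (\<Sum>i. p (A i))"
          by (intro LIMSEQ_le_const2) auto
      qed
    qed
  qed fact
  then show ?thesis
    by (simp add: p_def)
qed

text \<open>Each step splits off a piece of value at least \<open>1\<close> in modulus while the positive
  variation of the remainder stays infinite; the pieces are disjoint, so their values
  would have to be summable.\<close>

lemma finite_measure_pos_var:
  assumes Q: "signed_measure_on T Q"
  shows "finite_measure (pos_var Q)"
proof (rule finite_measureI, rule notI)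
  let ?p = "emeasure (pos_var Q)"
  assume inf: "?p (space (pos_var Q)) = \<infinity>"
  have step: "\<exists>B. (B \<in> sets borel \<and> ?p B = \<infinity>) \<and> (B \<subseteq> A \<and> \<bar>Q (A - B)\<bar> \<ge> 1)"
    if A: "A \<in> sets borel \<and> ?p A = \<infinity>" for A
  proof -
    \<comment> \<open>The threshold makes both halves large: \<open>Q E > 1\<close> and
      \<open>Q (A - E) = Q A - Q E < -1\<close>. Hence either half may be split off, and a half of
      infinite variation can be kept.\<close>
    have "ennreal (1 + \<bar>Q A\<bar>) < (\<Squnion>B\<in>{B\<in>sets borel. B \<subseteq> A}. ennreal (Q B))"
      using A emeasure_pos_var[OF Q, of A] by auto
    then obtain E where E: "E \<in> sets borel" "E \<subseteq> A" "ennreal (1 + \<bar>Q A\<bar>) < ennreal (Q E)"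
      unfolding less_SUP_iff by auto
    then have QE: "Q E > 1 + \<bar>Q A\<bar>"
      using E(3) by (subst (asm) ennreal_less_iff) auto
    have QD: "Q (A - E) = Q A - Q E"
      using A E by (intro signed_measure_on_Diff[OF Q]) auto
    have "?p E + ?p (A - E) = ?p (E \<union> (A - E))"
      using A E by (intro plus_emeasure) auto
    then have "?p E + ?p (A - E) = \<infinity>"
      using A E by (simp add: Un_absorb1)
    then consider "?p E = \<infinity>" | "?p (A - E) = \<infinity>"
      by (auto simp: ennreal_add_eq_top)
    then show ?thesis
    proof cases
      case 1
      then show ?thesis using E A QE QD by (intro exI[of _ E]) auto
    next
      case 2
      then show ?thesis using E A QE by (intro exI[of _ "A - E"]) (auto simp: double_diff)
    qed
  qed
  have "\<exists>A::nat \<Rightarrow> 'a set. \<forall>n. (A n \<in> sets borel \<and> ?p (A n) = \<infinity>) \<and>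
      (A (Suc n) \<subseteq> A n \<and> \<bar>Q (A n - A (Suc n))\<bar> \<ge> 1)"
    using inf step by (intro dependent_nat_choice) auto
  then obtain A :: "nat \<Rightarrow> 'a set" where A: "\<And>n. A n \<in> sets borel" "\<And>n. A (Suc n) \<subseteq> A n"
      "\<And>n. \<bar>Q (A n - A (Suc n))\<bar> \<ge> 1"
    by blast
  have "decseq A"
    using A(2) by (rule decseq_SucI)
  have "disjoint_family (\<lambda>n. A n - A (Suc n))"
    unfolding disjoint_family_on_def
  proof (intro ballI impI)
    fix m n :: nat assume "m \<noteq> n"
    then show "(A m - A (Suc m)) \<inter> (A n - A (Suc n)) = {}"
      using decseqD[OF \<open>decseq A\<close>, of "Suc m" n] decseqD[OF \<open>decseq A\<close>, of "Suc n" m]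
      by (cases m n rule: linorder_cases) auto
  qed
  then have "(\<lambda>n. Q (A n - A (Suc n))) sums Q (\<Union>n. A n - A (Suc n))"
    using A(1) by (intro signed_measure_on_sums[OF Q]) auto
  then have "(\<lambda>n. Q (A n - A (Suc n))) \<longlonglongrightarrow> 0"
    by (intro summable_LIMSEQ_zero sums_summable)
  then have "(\<lambda>n. \<bar>Q (A n - A (Suc n))\<bar>) \<longlonglongrightarrow> 0"
    by (simp add: tendsto_rabs_zero_iff)
  then have "1 \<le> (0::real)"
    by (rule LIMSEQ_le_const) (use A(3) in auto)
  then show False by simp
qed

lemma finite_measure_neg_var:
  assumes "signed_measure_on T Q"
  shows "finite_measure (neg_var Q)"
  unfolding neg_var_def using assms by (intro finite_measure_pos_var signed_measure_on_uminus)

lemma finite_measure_tot_var: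
  assumes "signed_measure_on T Q"
  shows "finite_measure (tot_var Q)"
proof (rule finite_measureI)
  interpret p: finite_measure "pos_var Q" using assms by (rule finite_measure_pos_var)
  interpret n: finite_measure "neg_var Q" using assms by (rule finite_measure_neg_var)
  show "emeasure (tot_var Q) (space (tot_var Q)) \<noteq> \<infinity>"
    unfolding emeasure_tot_var by simp
qed

text \<open>For \<open>B \<subseteq> A\<close>, additivity gives
  \<open>Q B = Q A - Q (A - B)\<close>, which is at most \<open>Q A\<close> plus the negative
  variation of \<open>A\<close>. The supremum over \<open>B\<close> yields one inequality; applied
  to \<open>-Q\<close>, which swaps the two variations, it yields the other.\<close>

lemma Jordan_decomposition:
  assumes Q: "signed_measure_on T Q" and A: "A \<in> sets borel"
  shows "Q A = measure (pos_var Q) A - measure (neg_var Q) A"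
proof -
  have le: "measure (pos_var P) A \<le> P A + measure (neg_var P) A" if P: "signed_measure_on T P" for P
  proof -
    interpret p: finite_measure "pos_var P" using P by (rule finite_measure_pos_var)
    interpret n: finite_measure "neg_var P" using P by (rule finite_measure_neg_var)
    have bound: "P B \<le> P A + measure (neg_var P) A" if B: "B \<in> sets borel" "B \<subseteq> A" for B
    proof -
      have "ennreal (- P (A - B)) \<le> emeasure (neg_var P) A"
        unfolding neg_var_def emeasure_pos_var[OF signed_measure_on_uminus[OF P] A]
        using A B by (intro SUP_upper) auto
      then have "- P (A - B) \<le> measure (neg_var P) A"
        by (simp add: n.emeasure_eq_measure ennreal_le_iff)
      then show ?thesis
        using signed_measure_on_Diff[OF P A B] by simp
    qed
    have "emeasure (pos_var P) A \<le> ennreal (P A + measure (neg_var P) A)"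
      unfolding emeasure_pos_var[OF P A] using bound by (intro SUP_least ennreal_leI) auto
    \<comment> \<open>Needed to leave \<open>ennreal\<close>, which would turn a negative bound into
      \<open>0\<close>. The choice \<open>B = {}\<close> provides it.\<close>
    moreover have "0 \<le> P A + measure (neg_var P) A"
      using bound[of "{}"] signed_measure_on_empty[OF P] by simp
    ultimately show ?thesis
      by (simp add: p.emeasure_eq_measure ennreal_le_iff)
  qed
  show ?thesis
    using le[OF Q] le[OF signed_measure_on_uminus[OF Q]] by (simp add: neg_var_def)
qed

subsection \<open>Integration against signed measures\<close>

lemma integrable_mono_measure:
  fixes f :: "'a \<Rightarrow> 'b::{banach, second_countable_topology}"
  assumes "sets M = sets N" "M \<le> N" "integrable N f"
  shows "integrable M f"
proof (rule integrableI_bounded)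
  show "f \<in> borel_measurable M"
    using borel_measurable_integrable[OF assms(3)] measurable_cong_sets[OF assms(1) refl] by blast
  have "(\<integral>\<^sup>+x. norm (f x) \<partial>M) \<le> (\<integral>\<^sup>+x. norm (f x) \<partial>N)"
    by (rule nn_integral_mono_measure) fact+
  also have "\<dots> < \<infinity>"
    using assms(3) by (simp add: integrable_iff_bounded)
  finally show "(\<integral>\<^sup>+x. norm (f x) \<partial>M) < \<infinity>" .
qed

lemma pos_var_le_tot_var: "pos_var Q \<le> tot_var Q"
  by (subst le_measure) (auto simp: emeasure_tot_var)

lemma neg_var_le_tot_var: "neg_var Q \<le> tot_var Q"
  by (subst le_measure) (auto simp: emeasure_tot_var)

lemma set_integrable_tot_varD:
  fixes g :: "'a::topological_space \<Rightarrow> 'b::{banach, second_countable_topology}"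
  assumes "set_integrable (tot_var Q) T g"
  shows "set_integrable (pos_var Q) T g" "set_integrable (neg_var Q) T g"
  using assms unfolding set_integrable_def
  by (auto intro: integrable_mono_measure[OF _ pos_var_le_tot_var]
      integrable_mono_measure[OF _ neg_var_le_tot_var])

text \<open>Dominated convergence with majorant \<open>2 * norm (h x)\<close>. Writing the simple
  integrals over level sets makes the measure enter only through its values on sets determined by
  \<open>F\<close>.\<close>

lemma (in finite_measure) integral_level_sets_limit:
  fixes h :: "'a \<Rightarrow> 'b::{banach, second_countable_topology}"
  assumes h: "integrable M h"
    and F: "\<And>k. simple_function M (F k)"
    and lim: "\<And>x. x \<in> space M \<Longrightarrow> (\<lambda>k. F k x) \<longlonglongrightarrow> h x"
    and bound: "\<And>k x. x \<in> space M \<Longrightarrow> norm (F k x) \<le> 2 * norm (h x)"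
  shows "(\<lambda>k. \<Sum>y\<in>F k ` space M. measure M {x\<in>space M. F k x = y} *\<^sub>R y) \<longlonglongrightarrow> integral\<^sup>L M h"
proof -
  have "Bochner_Integration.simple_bochner_integrable M (F k)" for k
    using F[of k] by (simp add: simple_bochner_integrable.simps)
  then have "integral\<^sup>L M (F k) = (\<Sum>y\<in>F k ` space M. measure M {x\<in>space M. F k x = y} *\<^sub>R y)" for k
    by (simp add: simple_bochner_integrable_eq_integral[symmetric] simple_bochner_integral_def)
  moreover have "(\<lambda>k. integral\<^sup>L M (F k)) \<longlonglongrightarrow> integral\<^sup>L M h"
  proof (rule integral_dominated_convergence[where w = "\<lambda>x. 2 * norm (h x)"])
    show "F k \<in> borel_measurable M" for k
      using F by (rule borel_measurable_simple_function)
  qed (use h lim bound in auto)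
  ultimately show ?thesis by simp
qed

text \<open>The approximating sums are visibly linear in \<open>Q\<close>, and the level sets do not depend on
  \<open>Q\<close>; this is how linearity of the integral in the signed measure is obtained.\<close>

lemma sm_integral_level_sets_limit:
  fixes g :: "'a::topological_space \<Rightarrow> 'b::{banach, second_countable_topology}"
  assumes g: "(\<lambda>t. indicator T t *\<^sub>R g t) \<in> borel_measurable borel"
  obtains F :: "nat \<Rightarrow> 'a \<Rightarrow> 'b" where
    "\<And>Q. signed_measure_on T Q \<Longrightarrow> set_integrable (tot_var Q) T g \<Longrightarrow>
      (\<lambda>k. \<Sum>y\<in>range (F k). Q {x. F k x = y} *\<^sub>R y) \<longlonglongrightarrow> sm_integral T Q g"
proof -
  let ?h = "\<lambda>t. indicator T t *\<^sub>R g t"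
  \<comment> \<open>\<open>F\<close> is chosen for the Borel algebra before any \<open>Q\<close> is
    fixed. The base point \<open>0\<close> of the metric approximation turns its bound into the
    majorant with factor \<open>2\<close>.\<close>
  obtain F where F: "\<And>k. simple_function borel (F k)" "\<And>x. (\<lambda>k. F k x) \<longlonglongrightarrow> ?h x"
      "\<And>k x. norm (F k x) \<le> 2 * norm (?h x)"
    using borel_measurable_implies_sequence_metric[OF g, of 0] by auto
  have level: "{x. F k x = y} \<in> sets borel" for k y
    using simple_functionD(2)[OF F(1), of k "{y}"] by (simp add: vimage_def)
  show thesis
  proof
    fix Q :: "'a set \<Rightarrow> real"
    assume Q: "signed_measure_on T Q" and int: "set_integrable (tot_var Q) T g"
    have lim: "(\<lambda>k. \<Sum>y\<in>range (F k). measure N {x. F k x = y} *\<^sub>R y) \<longlonglongrightarrow> (LINT t:T|N. g t)"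
      if N: "finite_measure N" "sets N = sets borel" "set_integrable N T g" for N
    proof -
      have sp: "space N = UNIV"
        using sets_eq_imp_space_eq[OF N(2)] by simp
      show ?thesis
        using finite_measure.integral_level_sets_limit[OF N(1), of ?h F] F N(3) sp
        by (simp add: set_integrable_def set_lebesgue_integral_def simple_function_cong_algebra[OF N(2)])
    qed
    have "(\<lambda>k. (\<Sum>y\<in>range (F k). measure (pos_var Q) {x. F k x = y} *\<^sub>R y) -
        (\<Sum>y\<in>range (F k). measure (neg_var Q) {x. F k x = y} *\<^sub>R y)) \<longlonglongrightarrow> sm_integral T Q g"
      unfolding sm_integral_def
      by (intro tendsto_diff lim set_integrable_tot_varD finite_measure_pos_var[OF Q]
          finite_measure_neg_var[OF Q] int) auto
    then show "(\<lambda>k. \<Sum>y\<in>range (F k). Q {x. F k x = y} *\<^sub>R y) \<longlonglongrightarrow> sm_integral T Q g"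
      by (simp add: Jordan_decomposition[OF Q level] scaleR_diff_left sum_subtractf)
  qed
qed

lemma sm_integral_linear_measure:
  fixes g :: "'a::topological_space \<Rightarrow> 'b::{banach, second_countable_topology}"
  assumes "signed_measure_on T P" "signed_measure_on T Q"
    and "signed_measure_on T (\<lambda>A. a * P A + b * Q A)"
    and "set_integrable (tot_var P) T g" "set_integrable (tot_var Q) T g"
    and "set_integrable (tot_var (\<lambda>A. a * P A + b * Q A)) T g"
  shows "sm_integral T (\<lambda>A. a * P A + b * Q A) g = a *\<^sub>R sm_integral T P g + b *\<^sub>R sm_integral T Q g"
proof -
  have "(\<lambda>t. indicator T t *\<^sub>R g t) \<in> borel_measurable (tot_var P)"
    using assms(4) unfolding set_integrable_def by (rule borel_measurable_integrable)
  then have meas: "(\<lambda>t. indicator T t *\<^sub>R g t) \<in> borel_measurable borel"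
    unfolding measurable_cong_sets[OF sets_tot_var refl] .
  \<comment> \<open>A single sequence serves \<open>P\<close>, \<open>Q\<close> and their
    combination, so uniqueness of limits can compare the three integrals.\<close>
  obtain F :: "nat \<Rightarrow> 'a \<Rightarrow> 'b" where
    F: "\<And>Q. signed_measure_on T Q \<Longrightarrow> set_integrable (tot_var Q) T g \<Longrightarrow>
      (\<lambda>k. \<Sum>y\<in>range (F k). Q {x. F k x = y} *\<^sub>R y) \<longlonglongrightarrow> sm_integral T Q g"
    using sm_integral_level_sets_limit[OF meas] by blast
  have "(\<lambda>k. a *\<^sub>R (\<Sum>y\<in>range (F k). P {x. F k x = y} *\<^sub>R y) +
      b *\<^sub>R (\<Sum>y\<in>range (F k). Q {x. F k x = y} *\<^sub>R y)) \<longlonglongrightarrow>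
      a *\<^sub>R sm_integral T P g + b *\<^sub>R sm_integral T Q g"
    using assms by (intro tendsto_add tendsto_scaleR tendsto_const F)
  then have "(\<lambda>k. \<Sum>y\<in>range (F k). (a * P {x. F k x = y} + b * Q {x. F k x = y}) *\<^sub>R y) \<longlonglongrightarrow>
      a *\<^sub>R sm_integral T P g + b *\<^sub>R sm_integral T Q g"
    by (simp add: scaleR_sum_right scaleR_add_left sum.distrib)
  then show ?thesis
    using F[OF assms(3,6)] LIMSEQ_unique by blast
qed

section \<open>Linear images of integrands and iterated integrals\<close>

lemma sm_integral_bounded_linear:
  fixes g :: "'a::topological_space \<Rightarrow> 'b::{banach, second_countable_topology}"
    and L :: "'b \<Rightarrow> 'c::{banach, second_countable_topology}"
  assumes L: "bounded_linear L" and g: "set_integrable (tot_var Q) T g"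
  shows "sm_integral T Q (\<lambda>t. L (g t)) = L (sm_integral T Q g)"
proof -
  interpret L: bounded_linear L by fact
  have "(LINT t:T|N. L (g t)) = L (LINT t:T|N. g t)" if "set_integrable N T g" for N
    using integral_bounded_linear[OF L that[unfolded set_integrable_def]]
    by (simp add: set_lebesgue_integral_def L.scaleR)
  then show ?thesis
    using set_integrable_tot_varD[OF g] by (simp add: sm_integral_def L.diff)
qed

lemma sm_integral_cong:
  assumes "\<And>t. t \<in> T \<Longrightarrow> g t = h t"
  shows "sm_integral T Q g = sm_integral T Q h"
proof -
  have "indicator T t *\<^sub>R g t = indicator T t *\<^sub>R h t" for t
    using assms by (cases "t \<in> T") auto
  then show ?thesis
    by (simp only: sm_integral_def set_lebesgue_integral_def)
qed

text \<open>Tonelli: the inner integrals against both variations of \<open>P\<close> are dominated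
  by the inner integral of the modulus of \<open>K\<close> against \<open>tot_var P\<close>. This
  makes the inner integral an admissible integrand for the outer measure.\<close>

lemma set_integrable_sm_integral:
  fixes K :: "'a::topological_space \<Rightarrow> 'b::topological_space \<Rightarrow> real"
  assumes P: "signed_measure_on S P" and Q: "signed_measure_on T Q"
    and K: "set_integrable (tot_var P \<Otimes>\<^sub>M tot_var Q) (S \<times> T) (\<lambda>(t, s). K t s)"
  shows "set_integrable (tot_var Q) T (\<lambda>s. sm_integral S P (\<lambda>t. K t s))"
proof -
  interpret P: finite_measure "tot_var P" using P by (rule finite_measure_tot_var)
  interpret Q: finite_measure "tot_var Q" using Q by (rule finite_measure_tot_var)
  interpret PQ: pair_sigma_finite "tot_var P" "tot_var Q" ..
  let ?k = "\<lambda>(t, s). indicator (S \<times> T) (t, s) *\<^sub>R K t s"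
  have k: "integrable (tot_var P \<Otimes>\<^sub>M tot_var Q) ?k"
    using K by (simp add: set_integrable_def case_prod_beta')
  have inner: "integrable (tot_var Q) (\<lambda>s. \<integral>t. ?k (t, s) \<partial>N)"
    if N: "finite_measure N" "sets N = sets borel" "N \<le> tot_var P" for N
  proof (rule integrableI_bounded)
    interpret N: finite_measure N by fact
    have "sets (tot_var Q \<Otimes>\<^sub>M N) = sets (tot_var Q \<Otimes>\<^sub>M tot_var P)"
      using N(2) by (intro sets_pair_measure_cong) auto
    moreover have "(\<lambda>(s, t). ?k (t, s)) \<in> borel_measurable (tot_var Q \<Otimes>\<^sub>M tot_var P)"
      using measurable_pair_swap[OF borel_measurable_integrable[OF k]] .
    ultimately have "(\<lambda>(s, t). ?k (t, s)) \<in> borel_measurable (tot_var Q \<Otimes>\<^sub>M N)"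
      by (simp cong: measurable_cong_sets)
    then show "(\<lambda>s. \<integral>t. ?k (t, s) \<partial>N) \<in> borel_measurable (tot_var Q)"
      by (rule N.borel_measurable_lebesgue_integral)
    have "ennreal (norm (\<integral>t. ?k (t, s) \<partial>N)) \<le> (\<integral>\<^sup>+t. norm (?k (t, s)) \<partial>tot_var P)" for s
    proof -
      \<comment> \<open>On a slice that is not integrable the Bochner integral is \<open>0\<close>
        by convention, so the bound is trivial there.\<close>
      have "ennreal (norm (\<integral>t. ?k (t, s) \<partial>N)) \<le> (\<integral>\<^sup>+t. norm (?k (t, s)) \<partial>N)"
        by (cases "integrable N (\<lambda>t. ?k (t, s))")
          (auto dest: integral_norm_bound_ennreal simp: not_integrable_integral_eq)
      also have "\<dots> \<le> (\<integral>\<^sup>+t. norm (?k (t, s)) \<partial>tot_var P)"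
        using N by (intro nn_integral_mono_measure) auto
      finally show ?thesis .
    qed
    then have "(\<integral>\<^sup>+s. norm (\<integral>t. ?k (t, s) \<partial>N) \<partial>tot_var Q)
        \<le> (\<integral>\<^sup>+s. (\<integral>\<^sup>+t. norm (?k (t, s)) \<partial>tot_var P) \<partial>tot_var Q)"
      by (intro nn_integral_mono)
    also have "\<dots> = (\<integral>\<^sup>+x. norm (?k x) \<partial>(tot_var P \<Otimes>\<^sub>M tot_var Q))"
      using k by (intro PQ.nn_integral_snd) auto
    also have "\<dots> < \<infinity>"
      using k by (simp add: integrable_iff_bounded)
    finally show "(\<integral>\<^sup>+s. norm (\<integral>t. ?k (t, s) \<partial>N) \<partial>tot_var Q) < \<infinity>" .
  qed
  have "integrable (tot_var Q) (\<lambda>s. (\<integral>t. ?k (t, s) \<partial>pos_var P) - (\<integral>t. ?k (t, s) \<partial>neg_var P))"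
    using finite_measure_pos_var[OF P] finite_measure_neg_var[OF P]
    by (intro Bochner_Integration.integrable_diff inner pos_var_le_tot_var neg_var_le_tot_var) auto
  moreover have "(\<lambda>s. (\<integral>t. ?k (t, s) \<partial>pos_var P) - (\<integral>t. ?k (t, s) \<partial>neg_var P)) =
      (\<lambda>s. indicator T s *\<^sub>R sm_integral S P (\<lambda>t. K t s))"
    by (auto simp: sm_integral_def set_lebesgue_integral_def indicator_def right_diff_distrib
        split: if_splits cong: if_cong)
  ultimately show ?thesis
    by (simp add: set_integrable_def)
qed

subsection \<open>Linear prediction\<close>

lemma linear_combination_in_class:
  fixes \<Q> :: "('a set \<Rightarrow> real) set"
  assumes closed: "\<And>P Q a b. P \<in> \<Q> \<Longrightarrow> Q \<in> \<Q> \<Longrightarrow> (\<lambda>A. a * P A + b * Q A) \<in> \<Q>"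
    and "finite I" and P: "P \<in> \<Q>" and Q: "\<And>i. i \<in> I \<Longrightarrow> Q i \<in> \<Q>"
  shows "(\<lambda>A. P A + (\<Sum>i\<in>I. c i * Q i A)) \<in> \<Q>"
  using \<open>finite I\<close> Q
proof (induction I)
  case (insert i I)
  then have "(\<lambda>A. 1 * (P A + (\<Sum>i\<in>I. c i * Q i A)) + c i * Q i A) \<in> \<Q>"
    by (intro closed) auto
  also have "(\<lambda>A. 1 * (P A + (\<Sum>i\<in>I. c i * Q i A)) + c i * Q i A) =
      (\<lambda>A. P A + (\<Sum>i\<in>insert i I. c i * Q i A))"
    using insert by (simp add: add_ac)
  finally show ?case .
qed (use P in simp)

text \<open>\<open>\<Phi>\<close> is vector valued so that one induction covers both the trend
  integral and the kernel form with one argument fixed.\<close>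

lemma linear_functional_combination:
  fixes \<Q> :: "('a set \<Rightarrow> real) set" and \<Phi> :: "('a set \<Rightarrow> real) \<Rightarrow> 'v::real_vector"
  assumes closed: "\<And>P Q a b. P \<in> \<Q> \<Longrightarrow> Q \<in> \<Q> \<Longrightarrow> (\<lambda>A. a * P A + b * Q A) \<in> \<Q>"
    and linear: "\<And>P Q a b. P \<in> \<Q> \<Longrightarrow> Q \<in> \<Q> \<Longrightarrow> \<Phi> (\<lambda>A. a * P A + b * Q A) = a *\<^sub>R \<Phi> P + b *\<^sub>R \<Phi> Q"
    and "finite I" and P: "P \<in> \<Q>" and Q: "\<And>i. i \<in> I \<Longrightarrow> Q i \<in> \<Q>"
  shows "\<Phi> (\<lambda>A. P A + (\<Sum>i\<in>I. c i * Q i A)) = \<Phi> P + (\<Sum>i\<in>I. c i *\<^sub>R \<Phi> (Q i))"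
  using \<open>finite I\<close> Q
proof (induction I)
  case (insert i I)
  have "(\<lambda>A. P A + (\<Sum>i\<in>insert i I. c i * Q i A)) =
      (\<lambda>A. 1 * (P A + (\<Sum>i\<in>I. c i * Q i A)) + c i * Q i A)"
    using insert by (simp add: add_ac)
  moreover have "\<Phi> (\<lambda>A. 1 * (P A + (\<Sum>i\<in>I. c i * Q i A)) + c i * Q i A) =
      1 *\<^sub>R \<Phi> (\<lambda>A. P A + (\<Sum>i\<in>I. c i * Q i A)) + c i *\<^sub>R \<Phi> (Q i)"
    using insert P by (intro linear linear_combination_in_class[OF closed]) auto
  ultimately show ?case
    using insert by (simp add: add_ac)
qed simp

text \<open>The first-order condition at a minimum; it turns the minimality of the BLUE into
  orthogonality.\<close>

lemma linear_coeff_eq_0_if_quadratic_nonneg: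
  fixes p q :: real
  assumes "\<And>x. 0 \<le> 2 * x * p + x\<^sup>2 * q"
  shows "p = 0"
proof (rule ccontr)
  assume "p \<noteq> 0"
  \<comment> \<open>With \<open>a > 0\<close> and \<open>q < a\<close>, the point
    \<open>x = - p / a\<close> gives \<open>p\<^sup>2 / a * (q / a - 2)\<close>, which is
    negative.\<close>
  define a where "a = \<bar>q\<bar> + 1"
  have "a > 0" "q < a"
    by (auto simp: a_def)
  have "0 \<le> 2 * (- p / a) * p + (- p / a)\<^sup>2 * q"
    by (rule assms)
  also have "\<dots> = p\<^sup>2 / a * (q / a - 2)"
    using \<open>a > 0\<close> by (simp add: field_simps power2_eq_square)
  also have "\<dots> < 0"
    using \<open>p \<noteq> 0\<close> \<open>a > 0\<close> \<open>q < a\<close>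
    by (intro mult_pos_neg) (auto simp: field_simps)
  finally show False by simp
qed

lemma integrable_mult_of_square_integrable:
  fixes X Y :: "'w \<Rightarrow> real"
  assumes "X \<in> borel_measurable M" "Y \<in> borel_measurable M"
    and "integrable M (\<lambda>w. (X w)\<^sup>2)" "integrable M (\<lambda>w. (Y w)\<^sup>2)"
  shows "integrable M (\<lambda>w. X w * Y w)"
proof (rule Bochner_Integration.integrable_bound)
  show "integrable M (\<lambda>w. (X w)\<^sup>2 + (Y w)\<^sup>2)"
    using assms by auto
  have "\<bar>X w * Y w\<bar> \<le> (X w)\<^sup>2 + (Y w)\<^sup>2" for w
    using sum_squares_bound[of "\<bar>X w\<bar>" "\<bar>Y w\<bar>"] zero_le_power2[of "X w"] zero_le_power2[of "Y w"]
      abs_ge_zero[of "X w * Y w"] unfolding abs_mult power2_abs by linarith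
  then show "AE w in M. norm (X w * Y w) \<le> norm ((X w)\<^sup>2 + (Y w)\<^sup>2)"
    by (intro AE_I2) simp
qed (use assms in measurable)

lemma centred_fieldD:
  assumes "centred_field M U K \<epsilon>" "t \<in> U"
  shows "\<epsilon> t \<in> borel_measurable M" "integrable M (\<lambda>w. (\<epsilon> t w)\<^sup>2)" "(LINT w|M. \<epsilon> t w) = 0"
  using assms unfolding centred_field_def by blast+

lemma centred_field_kernel:
  assumes "centred_field M U K \<epsilon>" "t \<in> U" "s \<in> U"
  shows "K t s = (LINT w|M. \<epsilon> t w * \<epsilon> s w)"
  using assms unfolding centred_field_def by blast

lemma (in prob_space) covariance_add_const:
  assumes "integrable M X" "integrable M Y"
  shows "covariance M (\<lambda>w. a + X w) (\<lambda>w. b + Y w) = covariance M X Y"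
  using assms by (simp add: covariance_def prob_space)

section \<open>Integrals as linear maps on the admissible class\<close>

context
  fixes T :: "(real ^ 'd) set" and t\<^sub>0 :: "real ^ 'd"
    and f :: "real ^ 'd \<Rightarrow> real ^ 'm"
    and K :: "real ^ 'd \<Rightarrow> real ^ 'd \<Rightarrow> real"
    and \<Q> :: "((real ^ 'd) set \<Rightarrow> real) set"
  assumes adm: "admissible_class T t\<^sub>0 f K \<Q>"
begin

lemma admissible_class_signed_measure: "Q \<in> \<Q> \<Longrightarrow> signed_measure_on T Q"
  using adm unfolding admissible_class_def by simp

lemma admissible_class_linear:
  "P \<in> \<Q> \<Longrightarrow> Q \<in> \<Q> \<Longrightarrow> (\<lambda>A. a * P A + b * Q A) \<in> \<Q>"
  using adm unfolding admissible_class_def by simp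

lemma admissible_class_integrable_trend: "Q \<in> \<Q> \<Longrightarrow> set_integrable (tot_var Q) T f"
  using adm unfolding admissible_class_def by simp

lemma admissible_class_integrable_kernel:
  "P \<in> \<Q> \<Longrightarrow> Q \<in> \<Q> \<Longrightarrow> set_integrable (tot_var Q) T (\<lambda>s. sm_integral T P (\<lambda>t. K t s))"
  using adm admissible_class_signed_measure unfolding admissible_class_def
  by (intro set_integrable_sm_integral) auto

lemma sm_integral_admissible_linear:
  fixes g :: "real ^ 'd \<Rightarrow> 'b::{banach, second_countable_topology}"
  assumes "\<And>Q. Q \<in> \<Q> \<Longrightarrow> set_integrable (tot_var Q) T g" and "P \<in> \<Q>" "Q \<in> \<Q>"
  shows "sm_integral T (\<lambda>A. a * P A + b * Q A) g = a *\<^sub>R sm_integral T P g + b *\<^sub>R sm_integral T Q g"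
  using admissible_class_linear[OF assms(2,3)] assms
  by (intro sm_integral_linear_measure admissible_class_signed_measure) auto

lemma sm_integral_trend_linear:
  "P \<in> \<Q> \<Longrightarrow> Q \<in> \<Q> \<Longrightarrow>
    sm_integral T (\<lambda>A. a * P A + b * Q A) f = a *\<^sub>R sm_integral T P f + b *\<^sub>R sm_integral T Q f"
  by (intro sm_integral_admissible_linear admissible_class_integrable_trend)

lemma sm_integral_kernel_linear:
  assumes "P \<in> \<Q>" "Q \<in> \<Q>"
  shows "sm_integral T (\<lambda>A. a * P A + b * Q A) (\<lambda>t. K t t\<^sub>0) =
    a * sm_integral T P (\<lambda>t. K t t\<^sub>0) + b * sm_integral T Q (\<lambda>t. K t t\<^sub>0)"
proof -
  have "set_integrable (tot_var Q) T (\<lambda>t. K t t\<^sub>0)" if "Q \<in> \<Q>" for Q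
    using adm that unfolding admissible_class_def by simp
  then show ?thesis
    using assms by (simp add: sm_integral_admissible_linear)
qed

text \<open>The right argument is the outer measure. Linearity in the inner one will come from
  symmetry.\<close>

lemma sm_double_integral_linear_right:
  assumes "R \<in> \<Q>" "P \<in> \<Q>" "Q \<in> \<Q>"
  shows "sm_double_integral T R (\<lambda>A. a * P A + b * Q A) K =
    a * sm_double_integral T R P K + b * sm_double_integral T R Q K"
  unfolding sm_double_integral_def
  using sm_integral_admissible_linear[OF admissible_class_integrable_kernel[OF assms(1)] assms(2,3)]
  by simp

lemma sm_integral_trend_nth:
  assumes "Q \<in> \<Q>"
  shows "sm_integral T Q (\<lambda>t. f t $ i) = sm_integral T Q f $ i"
  using admissible_class_integrable_trend[OF assms]
  by (intro sm_integral_bounded_linear bounded_linear_vec_nth)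

section \<open>Second moments of stochastic integrals and of prediction errors\<close>

context
  fixes M :: "'w measure" and \<epsilon> :: "real ^ 'd \<Rightarrow> 'w \<Rightarrow> real"
    and J :: "((real ^ 'd) set \<Rightarrow> real) \<Rightarrow> 'w \<Rightarrow> real"
  assumes prob: "prob_space M"
    and stoch: "stochastic_integral M T t\<^sub>0 K \<epsilon> \<Q> J"
begin

interpretation prob_space M by (rule prob)

lemma stochastic_integral_measurable: "Q \<in> \<Q> \<Longrightarrow> J Q \<in> borel_measurable M"
  and stochastic_integral_square_integrable: "Q \<in> \<Q> \<Longrightarrow> integrable M (\<lambda>w. (J Q w)\<^sup>2)"
  and stochastic_integral_centred: "Q \<in> \<Q> \<Longrightarrow> (LINT w|M. J Q w) = 0"
  using stoch unfolding stochastic_integral_def by auto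

lemma stochastic_integral_integrable: "Q \<in> \<Q> \<Longrightarrow> integrable M (J Q)"
  using stochastic_integral_measurable stochastic_integral_square_integrable
  by (rule square_integrable_imp_integrable)

lemma covariance_stochastic_integral:
  "P \<in> \<Q> \<Longrightarrow> Q \<in> \<Q> \<Longrightarrow> covariance M (J P) (J Q) = sm_double_integral T P Q K"
  using stoch unfolding stochastic_integral_def by auto

text \<open>As a second moment, the kernel form is visibly symmetric and nonnegative on the
  diagonal.\<close>

lemma sm_double_integral_eq_expectation:
  "P \<in> \<Q> \<Longrightarrow> Q \<in> \<Q> \<Longrightarrow> sm_double_integral T P Q K = (LINT w|M. J P w * J Q w)"
  using covariance_stochastic_integral[of P Q] by (simp add: covariance_def stochastic_integral_centred)

lemma sm_double_integral_commute:
  "P \<in> \<Q> \<Longrightarrow> Q \<in> \<Q> \<Longrightarrow> sm_double_integral T P Q K = sm_double_integral T Q P K"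
  by (simp add: sm_double_integral_eq_expectation mult.commute)

lemma sm_double_integral_nonneg:
  "Q \<in> \<Q> \<Longrightarrow> 0 \<le> sm_double_integral T Q Q K"
  by (simp add: sm_double_integral_eq_expectation)

lemma sm_double_integral_add_scaled:
  assumes "P \<in> \<Q>" "Q \<in> \<Q>"
  shows "sm_double_integral T (\<lambda>A. P A + x * Q A) (\<lambda>A. P A + x * Q A) K =
    sm_double_integral T P P K + 2 * x * sm_double_integral T P Q K + x\<^sup>2 * sm_double_integral T Q Q K"
proof -
  let ?R = "\<lambda>A. 1 * P A + x * Q A"
  have R: "?R \<in> \<Q>"
    using assms by (rule admissible_class_linear)
  note lin = sm_double_integral_linear_right[OF _ assms, of _ 1 x]
  \<comment> \<open>Expand in the outer measure, then use symmetry to move the remaining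
    \<open>?R\<close> there as well.\<close>
  have "sm_double_integral T ?R ?R K =
      sm_double_integral T P ?R K + x * sm_double_integral T Q ?R K"
    using assms R by (simp only: lin sm_double_integral_commute[OF R]) simp
  also have "\<dots> = sm_double_integral T P P K + 2 * x * sm_double_integral T P Q K
      + x\<^sup>2 * sm_double_integral T Q Q K"
    using assms sm_double_integral_commute[OF assms]
    by (simp only: lin) (simp add: algebra_simps power2_eq_square)
  finally show ?thesis by simp
qed

lemma unbiased_predictor_iff:
  assumes field: "centred_field M (T \<union> {t\<^sub>0}) K \<epsilon>" and Q: "Q \<in> \<Q>"
  shows "unbiased_predictor M T t\<^sub>0 f \<epsilon> J Q \<longleftrightarrow> sm_integral T Q f = f t\<^sub>0"
proof -
  have t\<^sub>0: "t\<^sub>0 \<in> T \<union> {t\<^sub>0}" by simp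
  have "integrable M (\<epsilon> t\<^sub>0)"
    using centred_fieldD(1,2)[OF field t\<^sub>0] by (rule square_integrable_imp_integrable)
  with centred_fieldD(3)[OF field t\<^sub>0]
  have "(LINT w|M. obs f \<epsilon> \<theta> t\<^sub>0 w) = \<theta> \<bullet> f t\<^sub>0" for \<theta>
    by (simp add: obs_def prob_space)
  moreover have "(LINT w|M. obs_integral T f J \<theta> Q w) = \<theta> \<bullet> sm_integral T Q f" for \<theta>
    using stochastic_integral_integrable[OF Q] stochastic_integral_centred[OF Q]
    by (simp add: obs_integral_def prob_space)
  ultimately show ?thesis
    unfolding unbiased_predictor_def by (simp add: vector_eq_ldot)
qed

text \<open>Unbiasedness cancels the trend for every \<open>\<theta>\<close>, leaving the error
  \<open>\<epsilon> t\<^sub>0 - J Q\<close>, whose square is expanded.\<close>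

lemma MSE_unbiased:
  assumes field: "centred_field M (T \<union> {t\<^sub>0}) K \<epsilon>"
    and Q: "Q \<in> \<Q>" and unb: "sm_integral T Q f = f t\<^sub>0"
  shows "MSE M T t\<^sub>0 f \<epsilon> J \<theta> Q =
    K t\<^sub>0 t\<^sub>0 - 2 * sm_integral T Q (\<lambda>t. K t t\<^sub>0) + sm_double_integral T Q Q K"
proof -
  have t\<^sub>0: "t\<^sub>0 \<in> T \<union> {t\<^sub>0}" by simp
  note \<epsilon> = centred_fieldD[OF field t\<^sub>0] centred_field_kernel[OF field t\<^sub>0 t\<^sub>0]
  note JQ = stochastic_integral_measurable[OF Q] stochastic_integral_square_integrable[OF Q]
  have "covariance M (J Q) (\<epsilon> t\<^sub>0) = sm_integral T Q (\<lambda>t. K t t\<^sub>0)"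
    using stoch Q unfolding stochastic_integral_def by auto
  then have cross: "(LINT w|M. J Q w * \<epsilon> t\<^sub>0 w) = sm_integral T Q (\<lambda>t. K t t\<^sub>0)"
    using \<epsilon> stochastic_integral_centred[OF Q] by (simp add: covariance_def)
  have "MSE M T t\<^sub>0 f \<epsilon> J \<theta> Q =
      (LINT w|M. \<epsilon> t\<^sub>0 w * \<epsilon> t\<^sub>0 w - 2 * (J Q w * \<epsilon> t\<^sub>0 w) + J Q w * J Q w)"
    unfolding MSE_def obs_def obs_integral_def unb
    by (intro Bochner_Integration.integral_cong) (auto simp: power2_eq_square algebra_simps)
  also have "\<dots> = K t\<^sub>0 t\<^sub>0 - 2 * sm_integral T Q (\<lambda>t. K t t\<^sub>0) + sm_double_integral T Q Q K"
    using \<epsilon> JQ integrable_mult_of_square_integrable[OF JQ(1) \<epsilon>(1) JQ(2) \<epsilon>(2)]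
    by (simp add: cross sm_double_integral_eq_expectation[OF Q Q] power2_eq_square)
  finally show ?thesis .
qed

lemma cov_matrix_linear_estimator:
  assumes "\<And>i. sm_component G i \<in> \<Q>"
  shows "cov_matrix M (linear_estimator T f J \<theta> G) =
    (\<chi> i j. sm_double_integral T (sm_component G i) (sm_component G j) K)"
  using assms by (simp add: cov_matrix_def linear_estimator_def obs_integral_def
      covariance_add_const stochastic_integral_integrable covariance_stochastic_integral)

text \<open>Perturbing the \<open>i\<close>-th component of the BLUE by a multiple of a measure that
  annihilates the trend keeps it unbiased, so the variance of the \<open>i\<close>-th component is
  stationary.\<close>

lemma BLUE_orthogonal:
  assumes G: "BLUE_measure M T f \<Q> J G" and R: "R \<in> \<Q>" and fR: "sm_integral T R f = 0"
  shows "sm_double_integral T (sm_component G i) R K = 0"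
proof (rule linear_coeff_eq_0_if_quadratic_nonneg)
  fix x :: real
  define H where "H = (\<lambda>A. G A + (x * R A) *\<^sub>R axis i 1)"
  have GQ: "sm_component G j \<in> \<Q>" for j
    using G unfolding BLUE_measure_def vector_measures_def by auto
  \<comment> \<open>The coefficient \<open>0\<close> for \<open>j \<noteq> i\<close> lets all
    components be treated as binary combinations of admissible measures.\<close>
  have H_comp: "sm_component H j = (\<lambda>A. 1 * sm_component G j A + (if j = i then x else 0) * R A)" for j
    by (auto simp: sm_component_def H_def axis_def)
  then have H_i: "sm_component H i = (\<lambda>A. sm_component G i A + x * R A)"
    by simp
  have HQ: "sm_component H j \<in> \<Q>" for j
    unfolding H_comp by (intro admissible_class_linear GQ R)
  have "signed_measure_on T H"
  proof -
    have "signed_measure_on T G"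
      using G unfolding BLUE_measure_def vector_measures_def by auto
    then show ?thesis
      using admissible_class_signed_measure[OF R] unfolding signed_measure_on_def H_def
      by (auto intro!: sums_add sums_mult bounded_linear.sums[OF bounded_linear_scaleR_left])
  qed
  then have H: "H \<in> vector_measures T \<Q>"
    using HQ by (auto simp: vector_measures_def)
  have "sm_integral T (sm_component H j) f = sm_integral T (sm_component G j) f" for j
    unfolding H_comp sm_integral_trend_linear[OF GQ R] fR by simp
  then have "unbiased_estimator T f H"
    using G unfolding BLUE_measure_def unbiased_estimator_def
    by (simp only: sm_integral_trend_nth[OF GQ] sm_integral_trend_nth[OF HQ])
  \<comment> \<open>The trend only shifts the estimators by constants, so their covariances do not
    depend on \<open>\<theta>\<close> and the value \<open>0\<close> may be taken.\<close>
  then have "loewner_le (cov_matrix M (linear_estimator T f J 0 G))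
      (cov_matrix M (linear_estimator T f J 0 H))"
    using G H unfolding BLUE_measure_def by blast
  \<comment> \<open>Testing the Loewner inequality at \<open>axis i 1\<close> reads off the diagonal
    entry \<open>i\<close>.\<close>
  then have "sm_double_integral T (sm_component G i) (sm_component G i) K
      \<le> sm_double_integral T (sm_component H i) (sm_component H i) K"
    unfolding loewner_le_def cov_matrix_linear_estimator[OF GQ] cov_matrix_linear_estimator[OF HQ]
    by (drule_tac spec[of _ "axis i 1"]) (simp add: matrix_vector_mult_basis inner_axis' column_def)
  then show "0 \<le> 2 * x * sm_double_integral T (sm_component G i) R K
      + x\<^sup>2 * sm_double_integral T R R K"
    using sm_double_integral_add_scaled[OF GQ R, of i x] by (simp only: H_i)
qed

end

end

section \<open>Optimality and mean squared error of the proposed predictor\<close>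

theorem theorem2p1:
  fixes T :: "(real ^ 'd) set" and t\<^sub>0 :: "real ^ 'd"
    and f :: "real ^ 'd \<Rightarrow> real ^ 'm"
    and K :: "real ^ 'd \<Rightarrow> real ^ 'd \<Rightarrow> real"
    and M :: "'w measure" and \<epsilon> :: "real ^ 'd \<Rightarrow> 'w \<Rightarrow> real"
    and \<Q> :: "((real ^ 'd) set \<Rightarrow> real) set"
    and J :: "((real ^ 'd) set \<Rightarrow> real) \<Rightarrow> 'w \<Rightarrow> real"
    and G :: "(real ^ 'd) set \<Rightarrow> real ^ 'm"
    and \<zeta> Qs :: "(real ^ 'd) set \<Rightarrow> real"
    and c :: "real ^ 'm" and D :: "real ^ 'm ^ 'm"
  assumes "T \<in> sets borel" and "t\<^sub>0 \<notin> T"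
    and "prob_space M"
    and "centred_field M (T \<union> {t\<^sub>0}) K \<epsilon>"
    and "strictly_pos_def (T \<union> {t\<^sub>0}) K"
    and "bounded (f ` T)" and "f \<in> borel_measurable (restrict_space borel T)"
    and "lin_indep_on T f"
    and "admissible_class T t\<^sub>0 f K \<Q>"
    and "stochastic_integral M T t\<^sub>0 K \<epsilon> \<Q> J"
    and "BLUE_measure M T f \<Q> J G"
    and "\<zeta> \<in> \<Q>" and "\<forall>s\<in>T. sm_integral T \<zeta> (\<lambda>t. K t s) = K t\<^sub>0 s"
  defines "c \<equiv> f t\<^sub>0 - sm_integral T \<zeta> f"
    and "Qs \<equiv> (\<lambda>A. \<zeta> A + c \<bullet> G A)"
    and "D \<equiv> (\<chi> i j. sm_double_integral T (sm_component G i) (sm_component G j) K)"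
  shows "BLUP_measure M T t\<^sub>0 f \<epsilon> \<Q> J Qs \<and>
    (\<forall>\<theta>. MSE M T t\<^sub>0 f \<epsilon> J \<theta> Qs =
       K t\<^sub>0 t\<^sub>0 + c \<bullet> (D *v f t\<^sub>0) - sm_integral T Qs (\<lambda>t. K t t\<^sub>0)) \<and>
    (\<forall>\<theta>. cov_matrix M (linear_estimator T f J \<theta> G) = D)"
proof -
  note prob = \<open>prob_space M\<close> and field = \<open>centred_field M (T \<union> {t\<^sub>0}) K \<epsilon>\<close>
    and adm = \<open>admissible_class T t\<^sub>0 f K \<Q>\<close> and stoch = \<open>stochastic_integral M T t\<^sub>0 K \<epsilon> \<Q> J\<close>
    and blue = \<open>BLUE_measure M T f \<Q> J G\<close> and \<zeta> = \<open>\<zeta> \<in> \<Q>\<close>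
  note commute = sm_double_integral_commute[OF adm prob stoch]
  let ?l = "\<lambda>Q. sm_integral T Q (\<lambda>t. K t t\<^sub>0)"
  let ?b = "\<lambda>P Q. sm_double_integral T P Q K"
  let ?G = "sm_component G"
  let ?comb = "\<lambda>P (a :: real ^ 'm) A. P A + (\<Sum>i\<in>UNIV. a $ i * ?G i A)"
  have GQ: "?G i \<in> \<Q>" for i
    using blue unfolding BLUE_measure_def vector_measures_def by auto
  have comb_Q: "?comb P a \<in> \<Q>" if "P \<in> \<Q>" for P a
    using that GQ by (intro linear_combination_in_class admissible_class_linear[OF adm]) auto
  have comb_b: "?b R (?comb P a) = ?b R P + (\<Sum>i\<in>UNIV. a $ i * ?b R (?G i))"
    if "R \<in> \<Q>" "P \<in> \<Q>" for R P a
  proof -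
    have "?b R (?comb P a) = ?b R P + (\<Sum>i\<in>UNIV. a $ i *\<^sub>R ?b R (?G i))"
    proof (rule linear_functional_combination[where \<Phi> = "\<lambda>Q. ?b R Q" and \<Q> = \<Q>])
      fix P Q a b assume "P \<in> \<Q>" "Q \<in> \<Q>"
      then show "?b R (\<lambda>A. a * P A + b * Q A) = a *\<^sub>R ?b R P + b *\<^sub>R ?b R Q"
        unfolding real_scaleR_def by (rule sm_double_integral_linear_right[OF adm that(1)])
    qed (use that GQ admissible_class_linear[OF adm] in auto)
    then show ?thesis by simp
  qed
  have G_unb: "sm_integral T (?G j) f = axis j 1" for j
  proof -
    have "(\<chi> i j. sm_integral T (?G j) (\<lambda>t. f t $ i)) = (mat 1 :: real ^ 'm ^ 'm)"
      using blue unfolding BLUE_measure_def unbiased_estimator_def by blast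
    then show ?thesis
      by (simp add: sm_integral_trend_nth[OF adm GQ] vec_eq_iff mat_def axis_def)
  qed
  \<comment> \<open>Unbiasedness of \<open>G\<close> means that adding \<open>a\<^sup>T G\<close>
    shifts the trend integral by exactly \<open>a\<close>. Hence the defect \<open>c\<close> of
    \<open>\<zeta>\<close> is the coefficient that makes \<open>Qs\<close> unbiased.\<close>
  have comb_f: "sm_integral T (?comb P a) f = sm_integral T P f + a" if "P \<in> \<Q>" for P a
  proof -
    have "sm_integral T (?comb P a) f = sm_integral T P f + (\<Sum>i\<in>UNIV. a $ i *\<^sub>R sm_integral T (?G i) f)"
      using that GQ by (intro linear_functional_combination[where \<Q> = \<Q>]
          admissible_class_linear[OF adm] sm_integral_trend_linear[OF adm]) auto
    also have "(\<Sum>i\<in>UNIV. a $ i *\<^sub>R sm_integral T (?G i) f) = a"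
      using basis_expansion[of a] by (simp add: G_unb scalar_mult_eq_scaleR)
    finally show ?thesis .
  qed
  have Qs: "Qs = ?comb \<zeta> c"
    by (simp add: Qs_def inner_vec_def sm_component_def)
  have QsQ: "Qs \<in> \<Q>"
    unfolding Qs by (rule comb_Q) fact
  have Qs_unb: "sm_integral T Qs f = f t\<^sub>0"
    unfolding Qs comb_f[OF \<zeta>] by (simp add: c_def)
  \<comment> \<open>The equation for \<open>\<zeta>\<close> prescribes the inner integral at every
    point of \<open>T\<close>, where the outer integral lives; symmetry of \<open>K\<close> follows
    from its covariance form.\<close>
  have b_\<zeta>: "?b \<zeta> R = ?l R" for R
    unfolding sm_double_integral_def
  proof (rule sm_integral_cong)
    fix s assume "s \<in> T"
    then have "K t\<^sub>0 s = K s t\<^sub>0"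
      using centred_field_kernel[OF field, of t\<^sub>0 s] centred_field_kernel[OF field, of s t\<^sub>0]
      by (simp add: mult.commute)
    then show "sm_integral T \<zeta> (\<lambda>t. K t s) = K s t\<^sub>0"
      using assms(13) \<open>s \<in> T\<close> by simp
  qed
  have b_Qs: "?b Qs R = ?l R + (\<Sum>i\<in>UNIV. c $ i * ?b (?G i) R)" if "R \<in> \<Q>" for R
    using commute[OF QsQ that] comb_b[OF that \<zeta>, of c] commute[OF that] \<zeta> GQ b_\<zeta>
    unfolding Qs by simp
  have orth: "?b (?G i) R = 0" if "R \<in> \<Q>" "sm_integral T R f = 0" for R i
    using BLUE_orthogonal[OF adm prob stoch blue that] .
  \<comment> \<open>\<open>Qs - f(t\<^sub>0)\<^sup>T G\<close> annihilates the trend, both parts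
    having trend integral \<open>f t\<^sub>0\<close>. Orthogonality to \<open>?G i\<close> then
    replaces \<open>Qs\<close> by \<open>f(t\<^sub>0)\<^sup>T G\<close>, which produces
    \<open>D\<close>.\<close>
  have "?b (?G i) Qs = (D *v f t\<^sub>0) $ i" for i
  proof -
    have "?b (?G i) (?comb Qs (- f t\<^sub>0)) = 0"
    proof (rule orth[OF comb_Q[OF QsQ]])
      show "sm_integral T (?comb Qs (- f t\<^sub>0)) f = 0"
        unfolding comb_f[OF QsQ] Qs_unb by simp
    qed
    then show ?thesis
      unfolding comb_b[OF GQ QsQ]
      by (simp add: D_def matrix_vector_mult_def sum_negf mult.commute)
  qed
  \<comment> \<open>Substituted into \<open>MSE_unbiased\<close>, this reduces
    \<open>- 2 * ?l Qs\<close> to a single \<open>- ?l Qs\<close>.\<close>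
  then have "?b Qs Qs = ?l Qs + c \<bullet> (D *v f t\<^sub>0)"
    unfolding b_Qs[OF QsQ] by (simp add: inner_vec_def)
  then have mse: "MSE M T t\<^sub>0 f \<epsilon> J \<theta> Qs = K t\<^sub>0 t\<^sub>0 + c \<bullet> (D *v f t\<^sub>0) - ?l Qs" for \<theta>
    unfolding MSE_unbiased[OF adm prob stoch field QsQ Qs_unb] by simp
  have optimal: "MSE M T t\<^sub>0 f \<epsilon> J \<theta> Qs \<le> MSE M T t\<^sub>0 f \<epsilon> J \<theta> Q"
    if Q: "Q \<in> \<Q>" and unb: "sm_integral T Q f = f t\<^sub>0" for \<theta> Q
  proof -
    \<comment> \<open>Pythagoras with \<open>Q = Qs + R\<close>: the cross terms
      \<open>- 2 * ?l R\<close> and \<open>2 * ?b Qs R\<close> cancel, so the two errors differ by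
      \<open>?b R R\<close>, which is nonnegative.\<close>
    define R where "R = (\<lambda>A. 1 * Q A + (- 1) * Qs A)"
    have R: "R \<in> \<Q>"
      unfolding R_def using Q QsQ by (rule admissible_class_linear[OF adm])
    have fR: "sm_integral T R f = 0"
      unfolding R_def sm_integral_trend_linear[OF adm Q QsQ] unb Qs_unb by simp
    have "?l R = ?l Q - ?l Qs"
      unfolding R_def sm_integral_kernel_linear[OF adm Q QsQ] by simp
    moreover have "?b Qs R = ?l R"
      unfolding b_Qs[OF R] by (simp add: orth[OF R fR])
    moreover have "?b Q Q = ?b Qs Qs + 2 * ?b Qs R + ?b R R"
      using sm_double_integral_add_scaled[OF adm prob stoch QsQ R, of 1] by (simp add: R_def)
    ultimately show ?thesis
      unfolding MSE_unbiased[OF adm prob stoch field Q unb]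
        MSE_unbiased[OF adm prob stoch field QsQ Qs_unb]
      using sm_double_integral_nonneg[OF adm prob stoch R] by simp
  qed
  have "BLUP_measure M T t\<^sub>0 f \<epsilon> \<Q> J Qs"
    unfolding BLUP_measure_def
    using QsQ Qs_unb optimal unbiased_predictor_iff[OF adm prob stoch field] by blast
  then show ?thesis
    using mse cov_matrix_linear_estimator[OF adm prob stoch GQ] by (simp add: D_def)
qed

end
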